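(* Let $t_0<t_f$. Let $n_r$ receiver positions $\mathbf{b}_1,\dots,\mathbf{b}_{n_r}\in\mathbb{R}^3$ be given, at least four of which are non-coplanar, and suppose that there are constants $R_{min}>0$, $R_{max}>0$ such that $R_{min}\le\rho_i(t)\le R_{max}$ for all $t\ge t_0$ and $i=1,\dots,n_r$. Then the linear time-varying system $$\dot{\mathbf{x}}(t)=\mathbf{A}(t)\mathbf{x}(t)+\mathbf{B}(t)\mathbf{u}(t),\qquad \mathbf{y}(t)=\mathbf{C}(t)\mathbf{x}(t),$$ with $\mathbf{x}(t)\in\mathbb{R}^{8+n_r}$ and with $\mathbf{A},\mathbf{B},\mathbf{C}$ as defined in the context, is observable on $[t_0,t_f]$; that is, its observability Gramian $\mathcal{W}(t_0,t_f)=\int_{t_0}^{t_f}\Phi^T(t,t_0)\mathbf{C}^T(t)\mathbf{C}(t)\Phi(t,t_0)\,dt$ is nonsingular, where $\Phi(t,t_0)$ is the state transition matrix associated with $\mathbf{A}(t)$.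
   Context: **Signals.** $\mathcal{R}(t)\in SO(3)$ is a rotation matrix satisfying $\dot{\mathcal{R}}(t)=\mathcal{R}(t)\mathcal{S}(\omega(t))$, where $\omega(t)\in\mathbb{R}^3$ is continuous and $\mathcal{S}(\omega)$ is the skew-symmetric matrix with $\mathcal{S}(\omega)a=\omega\times a$. The input $\mathbf{u}(t)\in\mathbb{R}^3$ is a known continuous bounded signal. The ranges $\rho_i$ are the outputs along a fixed trajectory $(\mathbf{x}_1(t),\mathbf{x}_2(t))\in\mathbb{R}^3\times\mathbb{R}^3$ of the nonlinear system $$\dot{\mathbf{x}}_1(t)=-\mathbf{x}_2(t)-\mathbf{u}(t),\quad \dot{\mathbf{x}}_2(t)=\mathbf{0},\quad \rho_i(t)=\|\mathbf{b}_i-\mathcal{R}^T(t)\mathbf{x}_1(t)\|,\ i=1,\dots,n_r .$$ The signals $\mathcal{R},\omega,\mathbf{u},\rho_1,\dots,\rho_{n_r}$ are treated as known functions of time, so that $\mathbf{A},\mathbf{B},\mathbf{C}$ below are known functions of time. **Matrices.** Split a vector of $\mathbb{R}^{8+n_r}$ into blocks of sizes $3,3,n_r,1,1$. With respect to this splitting, $$\mathbf{A}(t)=\begin{bmatrix}\mathbf{0}&-\mathbf{I}&\mathbf{0}&\mathbf{0}&\mathbf{0}\\ \mathbf{0}&\mathbf{0}&\mathbf{0}&\mathbf{0}&\mathbf{0}\\ \frac{\mathbf{b}_1^T\mathcal{S}(\omega(t))\mathcal{R}^T(t)-\mathbf{u}^T(t)}{\rho_1(t)}&\frac{\mathbf{b}_1^T\mathcal{R}^T(t)}{\rho_1(t)}&\mathbf{0}&-\frac1{\rho_1(t)}&0\\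 \vdots&\vdots&\vdots&\vdots&\vdots\\ \frac{\mathbf{b}_{n_r}^T\mathcal{S}(\omega(t))\mathcal{R}^T(t)-\mathbf{u}^T(t)}{\rho_{n_r}(t)}&\frac{\mathbf{b}_{n_r}^T\mathcal{R}^T(t)}{\rho_{n_r}(t)}&\mathbf{0}&-\frac1{\rho_{n_r}(t)}&0\\ \mathbf{0}&-\mathbf{u}^T(t)&\mathbf{0}&0&-1\\ \mathbf{0}&\mathbf{0}&\mathbf{0}&0&0\end{bmatrix},$$ $$\mathbf{B}(t)=\begin{bmatrix}-\mathbf{I}_3&\mathbf{0}&\frac{\mathcal{R}(t)\mathbf{b}_1}{\rho_1(t)}&\cdots&\frac{\mathcal{R}(t)\mathbf{b}_{n_r}}{\rho_{n_r}(t)}&\mathbf{0}&\mathbf{0}\end{bmatrix}^T,\qquad \mathbf{C}(t)=\begin{bmatrix}\mathbf{0}_{n_r\times3}&\mathbf{0}_{n_r\times3}&\mathbf{C}_0&\mathbf{0}_{n_r\times2}\\ \mathbf{C}_1(t)&\mathbf{0}_{n_C\times3}&\mathbf{C}_2&\mathbf{0}_{n_C\times2}\end{bmatrix},$$ where $n_C=n_r(n_r-1)/2$. Let $e_1,\dots,e_{n_r}$ be the standard basis of $\mathbb{R}^{n_r}$. $\mathbf{C}_0\in\mathbb{R}^{n_r\times n_r}$ has first row $e_1^T$ and $k$-th row $(e_1-e_k)^T$ for $k=2,\dots,n_r$. The rows of $\mathbf{C}_1(t)\in\mathbb{R}^{n_C\times3}$ and $\mathbf{C}_2\in\mathbb{R}^{n_C\times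 n_r}$ are indexed by the pairs $(i,j)$, $1\le i<j\le n_r$, in lexicographic order; the $(i,j)$ rows are respectively $\frac{2(\mathbf{b}_i-\mathbf{b}_j)^T\mathcal{R}^T(t)}{\rho_i(t)+\rho_j(t)}$ and $(e_i-e_j)^T$. *)

theory Defs
  imports "HOL-Analysis.Analysis"
begin

section \<open>Linear time-varying systems\<close>

record ('x::finite, 'u::finite, 'y::finite) ltv_system =
  sys_A :: "real \<Rightarrow> real^'x^'x"
  sys_B :: "real \<Rightarrow> real^'u^'x"
  sys_C :: "real \<Rightarrow> real^'x^'y"

text \<open>The value at \<open>t\<close> of the matrix solution of \<open>\<Phi>' = A \<Phi>\<close> with \<open>\<Phi>(t0) = I\<close>. The solution is only
  required to exist between \<open>t0\<close> and \<open>t\<close>, where it is unique for continuous \<open>A\<close>.\<close>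

definition state_transition :: "(real \<Rightarrow> real^'x^'x) \<Rightarrow> real \<Rightarrow> real \<Rightarrow> real^'x^'x" where
  "state_transition A t t0 = (THE X. \<exists>\<Phi>. \<Phi> t0 = mat 1 \<and>
     (\<forall>s \<in> closed_segment t0 t.
        (\<Phi> has_vector_derivative A s ** \<Phi> s) (at s within closed_segment t0 t)) \<and>
     X = \<Phi> t)"

definition observability_gramian ::
    "('x::finite, 'u::finite, 'y::finite) ltv_system \<Rightarrow> real \<Rightarrow> real \<Rightarrow> real^'x^'x" where
  "observability_gramian \<Sigma> t0 tf =
     integral {t0..tf} (\<lambda>t. transpose (state_transition (sys_A \<Sigma>) t t0) ** transpose (sys_C \<Sigma> t)
                            ** sys_C \<Sigma> t ** state_transition (sys_A \<Sigma>) t t0)"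

definition observable_on :: "('x::finite, 'u::finite, 'y::finite) ltv_system \<Rightarrow> real \<Rightarrow> real \<Rightarrow> bool" where
  "observable_on \<Sigma> t0 tf \<longleftrightarrow> invertible (observability_gramian \<Sigma> t0 tf)"


section \<open>Index types for states and receiver pairs\<close>

text \<open>The receivers are indexed by a finite linearly ordered type \<open>'n\<close>. The class \<open>card2\<close> (at least
  two elements) only serves to make the type of index pairs below nonempty.\<close>

datatype 'n state_idx = X1 3 | X2 3 | X3 'n | X4 | X5

lemma UNIV_state_idx:
  "UNIV = range X1 \<union> range X2 \<union> range X3 \<union> {X4, X5}"
proof (intro equalityI subsetI)
  fix x :: "'a state_idx"
  show "x \<in> range X1 \<union> range X2 \<union> range X3 \<union> {X4, X5}"
    by (cases x) simp_all
qed simp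

instance state_idx :: (finite) finite
proof
  have "finite (range X1 \<union> range X2 \<union> range X3 \<union> {X4, X5 :: 'a state_idx})"
    by simp
  then show "finite (UNIV :: 'a state_idx set)"
    by (simp only: UNIV_state_idx)
qed

lemma card_state_idx: "CARD('n::finite state_idx) = 8 + CARD('n)"
proof -
  let ?R1 = "range (X1 :: 3 \<Rightarrow> 'n state_idx)" and ?R2 = "range (X2 :: 3 \<Rightarrow> 'n state_idx)"
    and ?R3 = "range (X3 :: 'n \<Rightarrow> 'n state_idx)" and ?R4 = "{X4, X5 :: 'n state_idx}"
  have "card (?R1 \<union> ?R2) = card ?R1 + card ?R2"
    by (rule card_Un_disjoint) auto
  moreover have "card (?R1 \<union> ?R2 \<union> ?R3) = card (?R1 \<union> ?R2) + card ?R3"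
    by (rule card_Un_disjoint) auto
  moreover have "card (?R1 \<union> ?R2 \<union> ?R3 \<union> ?R4) = card (?R1 \<union> ?R2 \<union> ?R3) + card ?R4"
    by (rule card_Un_disjoint) auto
  ultimately have "CARD('n state_idx) = card ?R1 + card ?R2 + card ?R3 + card ?R4"
    by (simp only: UNIV_state_idx)
  then show ?thesis
    by (simp add: card_image inj_def)
qed

typedef (overloaded) 'n rcv_pair = "{(i, j). i < (j :: 'n :: {card2, linorder})}"
proof -
  obtain i j :: 'n where "i \<noteq> j"
    using two_le_card[where 'a = 'n] card_le_Suc0_iff_eq[of "UNIV :: 'n set"] by fastforce
  then show ?thesis
    by (cases i j rule: linorder_cases) auto
qed

instance rcv_pair :: ("{card2, linorder}") finite
proof
  have "(UNIV :: 'a rcv_pair set) = Abs_rcv_pair ` {(i, j). i < j}"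
    using type_definition.Abs_image[OF type_definition_rcv_pair] by (rule sym)
  moreover have "finite (Abs_rcv_pair ` {(i, j). i < (j :: 'a)})"
    by (rule finite_imageI) (rule finite)
  ultimately show "finite (UNIV :: 'a rcv_pair set)"
    by (simp only:)
qed

lemma card_rcv_pair:
  "CARD('n::{card2, linorder} rcv_pair) = CARD('n) * (CARD('n) - 1) div 2"
proof -
  let ?L = "{(i, j). i < (j :: 'n)}"
  let ?G = "{(i, j). j < (i :: 'n)}"
  let ?D = "range (\<lambda>i :: 'n. (i, i))"
  have "?G = prod.swap ` ?L"
    unfolding set_eq_iff image_iff by auto
  then have G: "card ?G = card ?L"
    by (simp only: card_image[OF inj_swap])
  have D: "card ?D = CARD('n)"
    by (simp add: card_image inj_def)
  have "(UNIV :: ('n \<times> 'n) set) = ?L \<union> ?G \<union> ?D"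
    by (auto simp: image_iff)
  then have "CARD('n \<times> 'n) = card (?L \<union> ?G \<union> ?D)"
    by (rule arg_cong)
  also have "\<dots> = card (?L \<union> ?G) + card ?D"
    by (rule card_Un_disjoint) auto
  also have "card (?L \<union> ?G) = card ?L + card ?G"
    by (rule card_Un_disjoint) auto
  finally have "CARD('n) * CARD('n) = 2 * card ?L + CARD('n)"
    unfolding G D by (simp only: card_prod mult_2)
  moreover have "CARD('n rcv_pair) = card ?L"
    using type_definition.card[OF type_definition_rcv_pair] by simp
  ultimately show ?thesis
    by (simp add: algebra_simps)
qed


section \<open>The range-based system\<close>

definition skew :: "real^3 \<Rightarrow> real^3^3" where
  "skew w = matrix (cross3 w)"

lemma skew_mult: "skew w *v a = cross3 w a"
  by (simp add: skew_def matrix_def matrix_vector_mult_def cross3_simps axis_def forall_3)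

definition range_A ::
    "('n \<Rightarrow> real^3) \<Rightarrow> (real \<Rightarrow> real^3^3) \<Rightarrow> (real \<Rightarrow> real^3) \<Rightarrow> (real \<Rightarrow> real^3) \<Rightarrow>
     ('n \<Rightarrow> real \<Rightarrow> real) \<Rightarrow> real \<Rightarrow> real^('n::finite state_idx)^('n state_idx)" where
  "range_A b R w u \<rho> t = (\<chi> p q.
     (case p of
        X1 i \<Rightarrow> (case q of X2 j \<Rightarrow> (- mat 1 :: real^3^3) $ i $ j | _ \<Rightarrow> 0)
      | X2 i \<Rightarrow> 0
      | X3 i \<Rightarrow> (case q of
            X1 j \<Rightarrow> (b i v* (skew (w t) ** transpose (R t)) - u t) $ j / \<rho> i t
          | X2 j \<Rightarrow> (b i v* transpose (R t)) $ j / \<rho> i t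
          | X3 j \<Rightarrow> 0
          | X4 \<Rightarrow> - 1 / \<rho> i t
          | X5 \<Rightarrow> 0)
      | X4 \<Rightarrow> (case q of X2 j \<Rightarrow> - u t $ j | X5 \<Rightarrow> - 1 | _ \<Rightarrow> 0)
      | X5 \<Rightarrow> 0))"

definition range_B ::
    "('n \<Rightarrow> real^3) \<Rightarrow> (real \<Rightarrow> real^3^3) \<Rightarrow> ('n \<Rightarrow> real \<Rightarrow> real) \<Rightarrow>
     real \<Rightarrow> real^3^('n::finite state_idx)" where
  "range_B b R \<rho> t = (\<chi> p j.
     (case p of
        X1 i \<Rightarrow> (- mat 1 :: real^3^3) $ i $ j
      | X3 i \<Rightarrow> (R t *v b i) $ j / \<rho> i t
      | _ \<Rightarrow> 0))"

text \<open>The four nonzero blocks of the output matrix are given by their rows: the first \<open>n\<close> rows of the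
  output matrix are indexed by the receivers, the others by the pairs \<open>i < j\<close> of receivers.\<close>

definition C0_row :: "'n \<Rightarrow> real^('n::{finite, linorder})" where
  "C0_row k = (if k = Min UNIV then axis k 1 else axis (Min UNIV) 1 - axis k 1)"

definition C1_row ::
    "('n \<Rightarrow> real^3) \<Rightarrow> (real \<Rightarrow> real^3^3) \<Rightarrow> ('n \<Rightarrow> real \<Rightarrow> real) \<Rightarrow> real \<Rightarrow> 'n \<times> 'n \<Rightarrow> real^3" where
  "C1_row b R \<rho> t = (\<lambda>(i, j). (2 / (\<rho> i t + \<rho> j t)) *\<^sub>R ((b i - b j) v* transpose (R t)))"

definition C2_row :: "'n \<times> 'n \<Rightarrow> real^('n::finite)" where
  "C2_row = (\<lambda>(i, j). axis i 1 - axis j 1)"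

definition range_C ::
    "('n \<Rightarrow> real^3) \<Rightarrow> (real \<Rightarrow> real^3^3) \<Rightarrow> ('n \<Rightarrow> real \<Rightarrow> real) \<Rightarrow>
     real \<Rightarrow> real^('n state_idx)^('n + 'n::{card2, linorder} rcv_pair)" where
  "range_C b R \<rho> t = (\<chi> r q.
     (case r of
        Inl k \<Rightarrow> (case q of X3 j \<Rightarrow> C0_row k $ j | _ \<Rightarrow> 0)
      | Inr p \<Rightarrow> (case q of
            X1 j \<Rightarrow> C1_row b R \<rho> t (Rep_rcv_pair p) $ j
          | X3 j \<Rightarrow> C2_row (Rep_rcv_pair p) $ j
          | _ \<Rightarrow> 0)))"

definition range_system ::
    "('n \<Rightarrow> real^3) \<Rightarrow> (real \<Rightarrow> real^3^3) \<Rightarrow> (real \<Rightarrow> real^3) \<Rightarrow> (real \<Rightarrow> real^3) \<Rightarrow>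
     ('n \<Rightarrow> real \<Rightarrow> real) \<Rightarrow> ('n state_idx, 3, 'n + 'n::{card2, linorder} rcv_pair) ltv_system" where
  "range_system b R w u \<rho> =
     \<lparr>sys_A = range_A b R w u \<rho>, sys_B = range_B b R \<rho>, sys_C = range_C b R \<rho>\<rparr>"

end

theory Submission
  imports Defs
begin

text \<open>The Gramian is singular exactly when some nonzero solution of \<open>x' = A x\<close> has zero output
  \<open>C x\<close> on the whole interval. For the range-based system such a solution vanishes block by block:
  the rows of \<open>C0\<close> kill \<open>X3\<close>; then the pair rows say that \<open>R\<^sup>T X1\<close> is orthogonal to every
  \<open>b i - b j\<close>, so \<open>X1 = 0\<close> because the receivers are not coplanar. As these blocks vanish
  identically in time, so do their derivatives, and the rows \<open>X1\<close>, \<open>X3\<close>, \<open>X4\<close> of the differential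
  equation give in turn \<open>X2 = 0\<close>, \<open>X4 = 0\<close> and \<open>X5 = 0\<close>.\<close>

section \<open>Linear differential equations\<close>

text \<open>Agreement is claimed only at the right endpoint, since an intermediate time is the
  endpoint of a shorter interval. The inner product on \<open>'b\<close> makes the squared distance
  of two solutions differentiable, and the abstract \<open>prod\<close> lets the unknown be a
  matrix.\<close>

lemma linear_ode_unique:
  fixes prod :: "'a::real_normed_vector \<Rightarrow> 'b::real_inner \<Rightarrow> 'b"
  assumes bil: "bounded_bilinear prod" and A: "continuous_on {a..b} A" and "a \<le> b"
    and x: "\<And>t. t \<in> {a..b} \<Longrightarrow> (x has_vector_derivative prod (A t) (x t)) (at t within {a..b})"
    and y: "\<And>t. t \<in> {a..b} \<Longrightarrow> (y has_vector_derivative prod (A t) (y t)) (at t within {a..b})"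
    and "x a = y a"
  shows "x b = y b"
proof -
  interpret bounded_bilinear prod by (rule bil)
  obtain K where K: "K > 0" "\<And>u v. norm (prod u v) \<le> norm u * norm v * K"
    using pos_bounded by blast
  obtain M where M: "\<And>t. t \<in> {a..b} \<Longrightarrow> norm (A t) \<le> M"
    using compact_imp_bounded[OF compact_continuous_image[OF A compact_Icc]]
    unfolding bounded_iff by blast
  define z where "z t = x t - y t" for t
  \<comment> \<open>Gronwall: the exponential weight makes the squared distance nonincreasing.\<close>
  define g where "g t = (z t \<bullet> z t) * exp (- (2 * M * K * t))" for t
  have z: "(z has_vector_derivative prod (A t) (z t)) (at t within {a..b})" if "t \<in> {a..b}" for t
    unfolding z_def diff_right by (intro has_vector_derivative_diff x y that)
  have g: "(g has_vector_derivative
      2 * (z t \<bullet> prod (A t) (z t) - M * K * (z t \<bullet> z t)) * exp (- (2 * M * K * t)))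
      (at t within {a..b})" if "t \<in> {a..b}" for t
  proof -
    have "((\<lambda>t. z t \<bullet> z t) has_vector_derivative 2 * (z t \<bullet> prod (A t) (z t))) (at t within {a..b})"
      using bounded_bilinear.has_vector_derivative[OF bounded_bilinear_inner z[OF that] z[OF that]]
      by (simp add: inner_commute)
    moreover have "((\<lambda>t. exp (- (2 * M * K * t))) has_vector_derivative
        - (2 * M * K) * exp (- (2 * M * K * t))) (at t within {a..b})"
      unfolding has_real_derivative_iff_has_vector_derivative[symmetric]
      by (auto intro!: derivative_eq_intros)
    ultimately show ?thesis
      unfolding g_def
      by (rule has_vector_derivative_eq_rhs[OF has_vector_derivative_mult]) (simp add: algebra_simps)
  qed
  have "g b \<le> g a"
  \<comment> \<open>Derivatives within \<open>{a..b}\<close> are two-sided only in the interior;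
    continuity of \<open>g\<close> covers the endpoints.\<close>
  proof (rule DERIV_nonpos_imp_decreasing_open[OF \<open>a \<le> b\<close>])
    show "continuous_on {a..b} g"
      by (meson continuous_on_eq_continuous_within g has_vector_derivative_continuous)
    fix t assume t: "a < t" "t < b"
    have "z t \<bullet> prod (A t) (z t) \<le> norm (z t) * (norm (A t) * norm (z t) * K)"
      by (rule order_trans[OF norm_cauchy_schwarz]) (intro mult_left_mono K norm_ge_zero)
    also have "\<dots> = norm (A t) * (K * (z t \<bullet> z t))"
      by (simp add: dot_square_norm power2_eq_square)
    also have "\<dots> \<le> M * (K * (z t \<bullet> z t))"
      using t K M by (intro mult_right_mono) auto
    finally have "z t \<bullet> prod (A t) (z t) - M * K * (z t \<bullet> z t) \<le> 0"
      by simp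
    then show "\<exists>d. (g has_real_derivative d) (at t) \<and> d \<le> 0"
      using g[of t] t
      by (auto simp: has_real_derivative_iff_has_vector_derivative at_within_Icc_at mult_le_0_iff)
  qed
  then have "z b \<bullet> z b \<le> 0"
    using \<open>x a = y a\<close> by (simp add: g_def z_def mult_le_0_iff)
  then have "z b = 0"
    by (metis inner_ge_zero inner_eq_zero_iff order_antisym)
  then show ?thesis
    by (simp add: z_def)
qed

text \<open>The increments of Picard's iteration are dominated by the terms of an exponential
  series, so they sum uniformly. The termwise derivatives are \<open>prod (A t)\<close> applied to
  the same series shifted by one, so they sum uniformly as well and the limit may be differentiated
  term by term.\<close>

lemma linear_ode_exists:
  fixes prod :: "'a::real_normed_vector \<Rightarrow> 'b::euclidean_space \<Rightarrow> 'b"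
  assumes bil: "bounded_bilinear prod" and A: "continuous_on {a..b} A"
  obtains x where "x a = c"
    "\<And>t. t \<in> {a..b} \<Longrightarrow> (x has_vector_derivative prod (A t) (x t)) (at t within {a..b})"
proof (cases "a \<le> b")
  case False
  then show ?thesis
    using that[of "\<lambda>_. c"] by auto
next
  case True
  interpret bounded_bilinear prod by (rule bil)
  obtain K where K: "K > 0" "\<And>u v. norm (prod u v) \<le> norm u * norm v * K"
    using pos_bounded by blast
  obtain M0 where M0: "\<And>t. t \<in> {a..b} \<Longrightarrow> norm (A t) \<le> M0"
    using compact_imp_bounded[OF compact_continuous_image[OF A compact_Icc]]
    unfolding bounded_iff by blast
  \<comment> \<open>\<open>M\<close> bounds the operator norms of all maps \<open>prod (A t)\<close>
    with \<open>t\<close> in the interval.\<close>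
  define M where "M = M0 * K"
  have M0_ge: "0 \<le> M0"
    using M0[of a] True norm_ge_zero[of "A a"] by (simp del: norm_ge_zero)
  have M: "norm (prod (A t) v) \<le> M * norm v" if "t \<in> {a..b}" for t v
  proof -
    have "norm (prod (A t) v) \<le> norm (A t) * (norm v * K)"
      using K(2) by (simp add: mult.assoc)
    also have "\<dots> \<le> M0 * (norm v * K)"
      using M0[OF that] K(1) by (intro mult_right_mono) auto
    finally show ?thesis
      by (simp add: M_def ac_simps)
  qed
  have M_ge: "0 \<le> M"
    using M0_ge K(1) by (simp add: M_def)
  \<comment> \<open>The increments of Picard's iteration; their sum is the Peano-Baker series.\<close>
  define P where "P = rec_nat (\<lambda>_. c) (\<lambda>_ p t. integral {a..t} (\<lambda>s. prod (A s) (p s)))"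
  have P_0: "P 0 = (\<lambda>_. c)" and
    P_Suc: "P (Suc n) = (\<lambda>t. integral {a..t} (\<lambda>s. prod (A s) (P n s)))" for n
    by (simp_all add: P_def)
  have P_cont: "continuous_on {a..b} (P n)" for n
  proof (induction n)
    case (Suc n)
    then show ?case
      unfolding P_Suc
      by (intro indefinite_integral_continuous_1 integrable_continuous_real continuous_on A)
  qed (simp add: P_0)
  have AP_cont: "continuous_on {a..b} (\<lambda>s. prod (A s) (P n s))" for n
    by (intro continuous_on A P_cont)
  have P_le: "norm (P n t) \<le> norm c * (M * (t - a)) ^ n / fact n" if "t \<in> {a..b}" for n t
    using that
  proof (induction n arbitrary: t)
    case (Suc n)
    \<comment> \<open>\<open>?f\<close> is \<open>M\<close> times the bound for increment
      \<open>n\<close>; its antiderivative \<open>?F\<close>, which vanishes at \<open>a\<close>, is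
      the bound for increment \<open>Suc n\<close>.\<close>
    let ?f = "\<lambda>s. M * (norm c * (M * (s - a)) ^ n / fact n)"
    let ?F = "\<lambda>s. norm c * (M * (s - a)) ^ Suc n / fact (Suc n)"
    have "(?f has_integral ?F t - ?F a) {a..t}"
    proof (rule fundamental_theorem_of_calculus)
      fix s assume "s \<in> {a..t}"
      have "(?F has_real_derivative ?f s) (at s within {a..t})"
        by (rule derivative_eq_intros refl | simp del: of_nat_Suc)+
      then show "(?F has_vector_derivative ?f s) (at s within {a..t})"
        by (simp only: has_real_derivative_iff_has_vector_derivative)
    qed (use Suc in simp)
    then have f: "(?f has_integral ?F t) {a..t}"
      by simp
    have sub: "{a..t} \<subseteq> {a..b}"
      using Suc.prems by auto
    have "norm (P (Suc n) t) \<le> integral {a..t} ?f"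
      unfolding P_Suc
    proof (rule integral_norm_bound_integral)
      show "(\<lambda>s. prod (A s) (P n s)) integrable_on {a..t}"
        using continuous_on_subset[OF AP_cont sub] by (rule integrable_continuous_real)
      show "?f integrable_on {a..t}"
        using f by (rule has_integral_integrable)
      fix s assume "s \<in> {a..t}"
      with sub have s: "s \<in> {a..b}" by auto
      show "norm (prod (A s) (P n s)) \<le> ?f s"
        by (rule order_trans[OF M[OF s]]) (intro mult_left_mono Suc.IH[OF s] M_ge)
    qed
    then show ?case
      using f by (simp only: integral_unique)
  qed (simp add: P_0)
  \<comment> \<open>The bound is now independent of \<open>t\<close> and has the shape of the
    exponential series, as the Weierstrass test requires.\<close>
  have P_bound: "norm (P n t) \<le> norm c * (inverse (fact n) * (M * (b - a)) ^ n)"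
    if "t \<in> {a..b}" for n t
  proof -
    have "(M * (t - a)) ^ n \<le> (M * (b - a)) ^ n"
      using that M_ge by (intro power_mono mult_left_mono) auto
    then have "norm c * (M * (t - a)) ^ n / fact n \<le> norm c * (M * (b - a)) ^ n / fact n"
      by (intro divide_right_mono mult_left_mono) auto
    with P_le[OF that, of n] show ?thesis
      by (simp add: field_simps)
  qed
  define S where "S t = (\<Sum>n. P n t)" for t
  have unif: "uniform_limit {a..b} (\<lambda>n t. \<Sum>i<n. P i t) S sequentially"
    unfolding S_def
    by (rule Weierstrass_m_test[OF P_bound])
       (simp_all add: summable_mult summable_exp)
  have S_sums: "(\<lambda>n. P n t) sums S t" if "t \<in> {a..b}" for t
    unfolding sums_def using tendsto_uniform_limitI[OF unif that] .
  \<comment> \<open>\<open>D n\<close> is the derivative of \<open>P n\<close>, zero for the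
    constant \<open>P 0\<close>. Hence the first \<open>Suc n\<close> derivatives add up to
    \<open>prod (A t)\<close> of the first \<open>n\<close> increments, and the estimate below is
    proved for \<open>Suc n\<close>.\<close>
  define D where "D n t = (case n of 0 \<Rightarrow> 0 | Suc m \<Rightarrow> prod (A t) (P m t))" for n t
  have "\<exists>g. \<forall>t\<in>{a..b}. (\<lambda>n. P n t) sums g t \<and>
      (g has_derivative (\<lambda>h. h *\<^sub>R prod (A t) (S t))) (at t within {a..b})"
  proof (rule has_derivative_series[where f' = "\<lambda>n t h. h *\<^sub>R D n t" and x = a])
    show "(P n has_derivative (\<lambda>h. h *\<^sub>R D n t)) (at t within {a..b})" if "t \<in> {a..b}" for n t
      unfolding has_vector_derivative_def[symmetric]
    proof (cases n)
      case (Suc m)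
      then show "(P n has_vector_derivative D n t) (at t within {a..b})"
        using integral_has_vector_derivative[OF AP_cont that] by (simp add: P_Suc D_def)
    qed (simp add: P_0 D_def)
    fix e :: real assume "e > 0"
    \<comment> \<open>Dividing by \<open>M + 1\<close> allows for \<open>M = 0\<close>.\<close>
    define e' where "e' = e / (M + 1)"
    have e': "e' > 0" "M * e' \<le> e"
      using \<open>e > 0\<close> M_ge by (auto simp: e'_def field_simps)
    from uniform_limitD[OF unif e'(1)]
    have "\<forall>\<^sub>F n in sequentially. \<forall>t\<in>{a..b}. \<forall>h.
      norm ((\<Sum>i<Suc n. h *\<^sub>R D i t) - h *\<^sub>R prod (A t) (S t)) \<le> e * norm h"
    proof eventually_elim
      case (elim n)
      show ?case
      proof (intro ballI allI)
        fix t h assume t: "t \<in> {a..b}"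
        have "(\<Sum>i<Suc n. h *\<^sub>R D i t) - h *\<^sub>R prod (A t) (S t)
            = h *\<^sub>R prod (A t) ((\<Sum>i<n. P i t) - S t)"
          by (simp add: sum.lessThan_Suc_shift D_def scaleR_diff_right diff_right sum_right
              scaleR_sum_right del: sum.lessThan_Suc)
        moreover have "norm (prod (A t) ((\<Sum>i<n. P i t) - S t)) \<le> e"
        proof -
          have "norm ((\<Sum>i<n. P i t) - S t) \<le> e'"
            using elim t by (simp add: dist_norm less_imp_le)
          then have "M * norm ((\<Sum>i<n. P i t) - S t) \<le> M * e'"
            using M_ge by (rule mult_left_mono)
          with M[OF t] e'(2) show ?thesis
            by (meson order_trans)
        qed
        ultimately show "norm ((\<Sum>i<Suc n. h *\<^sub>R D i t) - h *\<^sub>R prod (A t) (S t)) \<le> e * norm h"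
          by (simp add: mult.commute[of e] mult_left_mono)
      qed
    qed
    then show "\<forall>\<^sub>F n in sequentially. \<forall>t\<in>{a..b}. \<forall>h.
      norm ((\<Sum>i<n. h *\<^sub>R D i t) - h *\<^sub>R prod (A t) (S t)) \<le> e * norm h"
      by (rule eventually_sequentially_Suc[THEN iffD1])
  qed (use True S_sums in auto)
  then obtain g where g: "\<And>t. t \<in> {a..b} \<Longrightarrow> (\<lambda>n. P n t) sums g t"
    "\<And>t. t \<in> {a..b} \<Longrightarrow> (g has_vector_derivative prod (A t) (S t)) (at t within {a..b})"
    unfolding has_vector_derivative_def by blast
  \<comment> \<open>Termwise differentiation gives some limit \<open>g\<close> whose derivative is
    expressed through \<open>S\<close>; uniqueness of limits closes the equation.\<close>
  have gS: "g t = S t" if "t \<in> {a..b}" for t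
    using sums_unique2[OF g(1) S_sums] that by blast
  show ?thesis
  proof (rule that)
    have "P n a = (if n = 0 then c else 0)" for n
      by (cases n) (simp_all add: P_0 P_Suc)
    then have "(\<lambda>n. P n a) sums c"
      using sums_single[of 0 "\<lambda>_. c"] by simp
    then show "g a = c"
      using sums_unique2 g(1)[of a] True by fastforce
    show "(g has_vector_derivative prod (A t) (g t)) (at t within {a..b})" if "t \<in> {a..b}" for t
      using g(2)[OF that] gS[OF that] by simp
  qed
qed

section \<open>Matrix operations as bounded linear and bilinear maps\<close>

lemma bounded_bilinear_matrix_matrix_mult:
  "bounded_bilinear ((**) :: real^'n::finite^'m::finite \<Rightarrow> real^'p::finite^'n \<Rightarrow> real^'p^'m)"
  unfolding bilinear_conv_bounded_bilinear[symmetric] bilinear_def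
  by (auto intro!: linearI simp: matrix_matrix_mult_def vec_eq_iff sum.distrib sum_distrib_left
      distrib_left distrib_right mult_ac)

lemma bounded_bilinear_matrix_vector_mult:
  "bounded_bilinear ((*v) :: real^'n::finite^'m::finite \<Rightarrow> real^'n \<Rightarrow> real^'m)"
  unfolding bilinear_conv_bounded_bilinear[symmetric] bilinear_def
  by (auto intro!: linearI simp: matrix_vector_mult_def vec_eq_iff sum.distrib sum_distrib_left
      distrib_left distrib_right mult_ac)

lemma bounded_linear_transpose:
  "bounded_linear (transpose :: real^'n::finite^'m::finite \<Rightarrow> real^'m^'n)"
  unfolding linear_conv_bounded_linear[symmetric]
  by (rule linearI) (simp_all add: transpose_def vec_eq_iff)

section \<open>Observability\<close>

text \<open>Resolves the definite description: for \<open>t\<close> to the right of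
  \<open>t0\<close> the segment is \<open>{t0..t}\<close>, where the restriction of \<Phi> is a
  solution and any other solution ends at the same value.\<close>

lemma state_transition_eqI:
  assumes A: "continuous_on {t0..tf} A" and t: "t \<in> {t0..tf}" and "\<Phi> t0 = mat 1"
    and \<Phi>: "\<And>s. s \<in> {t0..tf} \<Longrightarrow> (\<Phi> has_vector_derivative A s ** \<Phi> s) (at s within {t0..tf})"
  shows "state_transition A t t0 = \<Phi> t"
  unfolding state_transition_def
proof (rule the_equality)
  have seg: "closed_segment t0 t = {t0..t}" "{t0..t} \<subseteq> {t0..tf}"
    using t by (auto simp: closed_segment_eq_real_ivl)
  have \<Phi>': "(\<Phi> has_vector_derivative A s ** \<Phi> s) (at s within {t0..t})" if "s \<in> {t0..t}" for s
    using has_vector_derivative_within_subset[OF \<Phi> seg(2)] that seg(2) by blast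
  then show "\<exists>\<Psi>. \<Psi> t0 = mat 1 \<and>
      (\<forall>s\<in>closed_segment t0 t. (\<Psi> has_vector_derivative A s ** \<Psi> s)
        (at s within closed_segment t0 t)) \<and> \<Phi> t = \<Psi> t"
    using \<open>\<Phi> t0 = mat 1\<close> seg by auto
  fix X
  assume "\<exists>\<Psi>. \<Psi> t0 = mat 1 \<and>
      (\<forall>s\<in>closed_segment t0 t. (\<Psi> has_vector_derivative A s ** \<Psi> s)
        (at s within closed_segment t0 t)) \<and> X = \<Psi> t"
  then obtain \<Psi> where "\<Psi> t0 = mat 1" "X = \<Psi> t"
    "\<And>s. s \<in> {t0..t} \<Longrightarrow> (\<Psi> has_vector_derivative A s ** \<Psi> s) (at s within {t0..t})"
    unfolding seg by blast
  with linear_ode_unique[OF bounded_bilinear_matrix_matrix_mult continuous_on_subset[OF A seg(2)] _ this(3) \<Phi>']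
  show "X = \<Phi> t"
    using t \<open>\<Phi> t0 = mat 1\<close> by auto
qed

text \<open>The quadratic form of the Gramian at \<open>v\<close> is the integral of the squared
  output norm along the solution starting at \<open>v\<close>. If \<open>v\<close> lies in the
  kernel, this continuous nonnegative integrand has integral zero, so the output vanishes
  identically. A square matrix with trivial kernel is invertible.\<close>

lemma observable_onI:
  assumes "t0 < tf"
    and A: "continuous_on {t0..tf} (sys_A \<Sigma>)" and C: "continuous_on {t0..tf} (sys_C \<Sigma>)"
    and zero: "\<And>x. (\<And>t. t \<in> {t0..tf} \<Longrightarrow>
        (x has_vector_derivative sys_A \<Sigma> t *v x t) (at t within {t0..tf})) \<Longrightarrow>
      (\<And>t. t \<in> {t0..tf} \<Longrightarrow> sys_C \<Sigma> t *v x t = 0) \<Longrightarrow> x t0 = 0"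
  shows "observable_on \<Sigma> t0 tf"
proof -
  obtain \<Phi> where \<Phi>0: "\<Phi> t0 = mat 1" and
    \<Phi>: "\<And>t. t \<in> {t0..tf} \<Longrightarrow> (\<Phi> has_vector_derivative sys_A \<Sigma> t ** \<Phi> t) (at t within {t0..tf})"
    by (rule linear_ode_exists[OF bounded_bilinear_matrix_matrix_mult A, where c = "mat 1"]) blast
  define G where "G t = transpose (\<Phi> t) ** transpose (sys_C \<Sigma> t) ** sys_C \<Sigma> t ** \<Phi> t" for t
  have W: "observability_gramian \<Sigma> t0 tf = integral {t0..tf} G"
    unfolding observability_gramian_def G_def
    using state_transition_eqI[where \<Phi> = \<Phi>, OF A _ \<Phi>0 \<Phi>]
    by (intro Henstock_Kurzweil_Integration.integral_cong) simp
  have \<Phi>_cont: "continuous_on {t0..tf} \<Phi>"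
    by (meson \<Phi> continuous_on_eq_continuous_within has_vector_derivative_continuous)
  have G_cont: "continuous_on {t0..tf} G"
    unfolding G_def
    by (intro bounded_bilinear.continuous_on[OF bounded_bilinear_matrix_matrix_mult]
        bounded_linear.continuous_on[OF bounded_linear_transpose] \<Phi>_cont C)
  \<comment> \<open>Linearity in the matrix argument lets the quadratic form pass under the
    integral.\<close>
  have quad: "bounded_linear (\<lambda>X :: real^_^_. v \<bullet> (X *v v))" for v
    using bounded_linear_compose[OF bounded_linear_inner_right
        bounded_bilinear.bounded_linear_left[OF bounded_bilinear_matrix_vector_mult]] .
  have G_quad: "v \<bullet> (G t *v v) = (norm (sys_C \<Sigma> t *v (\<Phi> t *v v)))\<^sup>2" for v t
    unfolding G_def power2_norm_eq_inner
    by (subst inner_commute) (simp add: matrix_vector_mul_assoc[symmetric] dot_lmul_matrix[symmetric]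
        del: matrix_vector_mul_assoc)
  have "v = 0" if v: "integral {t0..tf} G *v v = 0" for v
  proof -
    have "integral {t0..tf} (\<lambda>t. v \<bullet> (G t *v v)) = v \<bullet> (integral {t0..tf} G *v v)"
      using integral_linear[OF integrable_continuous_real[OF G_cont] quad] by (simp add: o_def)
    then have "integral {t0..tf} (\<lambda>t. v \<bullet> (G t *v v)) = 0"
      by (simp add: v)
    moreover have "continuous_on {t0..tf} (\<lambda>t. v \<bullet> (G t *v v))"
      by (rule bounded_linear.continuous_on[OF quad G_cont])
    ultimately have "\<forall>t\<in>{t0..tf}. v \<bullet> (G t *v v) = 0"
      using integral_eq_0_iff[of t0 tf "\<lambda>t. v \<bullet> (G t *v v)"] \<open>t0 < tf\<close> by (simp add: G_quad)
    then have out: "sys_C \<Sigma> t *v (\<Phi> t *v v) = 0" if "t \<in> {t0..tf}" for t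
      using that by (simp add: G_quad)
    have "\<Phi> t0 *v v = 0"
    proof (rule zero[OF _ out])
      fix t assume "t \<in> {t0..tf}"
      from bounded_linear.has_vector_derivative[OF
          bounded_bilinear.bounded_linear_left[OF bounded_bilinear_matrix_vector_mult] \<Phi>[OF this]]
      show "((\<lambda>t. \<Phi> t *v v) has_vector_derivative sys_A \<Sigma> t *v (\<Phi> t *v v)) (at t within {t0..tf})"
        by (simp add: matrix_vector_mul_assoc)
    qed
    then show ?thesis
      by (simp add: \<Phi>0)
  qed
  then show ?thesis
    unfolding observable_on_def W invertible_left_inverse matrix_left_invertible_ker by blast
qed

section \<open>Non-coplanar points in space\<close>

lemma coplanar_hyperplane:
  fixes w :: "real^3"
  assumes "w \<noteq> 0"
  shows "coplanar {x. w \<bullet> x = c}"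
proof -
  \<comment> \<open>Coplanarity asks for three points whose affine hull contains the set; an affine
    basis of a two-dimensional plane supplies them.\<close>
  have "aff_dim {x. w \<bullet> x = c} = 2"
    using assms by (simp add: aff_dim_hyperplane)
  then obtain B where B: "affine hull B = affine hull {x. w \<bullet> x = c}" "card B = 3"
    using aff_dim_basis_exists[of "{x. w \<bullet> x = c}"] by auto
  then obtain p q r where "B = {p, q, r}"
    by (auto simp: card_3_iff)
  then show ?thesis
    using B(1) hull_subset[of "{x. w \<bullet> x = c}" affine] unfolding coplanar_def by metis
qed

text \<open>A nonzero \<open>w\<close> orthogonal to all differences would be normal to one plane
  containing every point.\<close>

lemma not_coplanar_imp_eq_0:
  fixes b :: "'n \<Rightarrow> real^3"
  assumes "\<not> coplanar (range b)" and "\<And>i j. (b i - b j) \<bullet> w = 0"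
  shows "w = 0"
proof (rule ccontr)
  assume "w \<noteq> 0"
  have "w \<bullet> b i = w \<bullet> b j" for i j
    using assms(2)[of i j] by (simp add: inner_commute inner_diff_right)
  \<comment> \<open>\<open>undefined\<close> is just some index: \<open>w\<close> has the same inner
    product with every point.\<close>
  then have "range b \<subseteq> {x. w \<bullet> x = w \<bullet> b undefined}"
    by auto
  then show False
    using coplanar_subset[OF coplanar_hyperplane[OF \<open>w \<noteq> 0\<close>]] assms(1) by blast
qed


section \<open>The range-based system\<close>

lemma sum_state_idx:
  fixes f :: "'n::finite state_idx \<Rightarrow> 'a::comm_monoid_add"
  shows "sum f UNIV = (\<Sum>i\<in>UNIV. f (X1 i)) + (\<Sum>i\<in>UNIV. f (X2 i)) + (\<Sum>i\<in>UNIV. f (X3 i))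
    + (f X4 + f X5)"
proof -
  have "sum f UNIV = sum f (range X1 \<union> range X2 \<union> range X3) + sum f {X4, X5}"
    unfolding UNIV_state_idx by (rule sum.union_disjoint) auto
  also have "sum f (range X1 \<union> range X2 \<union> range X3) = sum f (range X1 \<union> range X2) + sum f (range X3)"
    by (rule sum.union_disjoint) auto
  also have "sum f (range X1 \<union> range X2) = sum f (range X1) + sum f (range X2)"
    by (rule sum.union_disjoint) auto
  finally show ?thesis
    by (simp add: sum.reindex inj_def)
qed

lemma range_A_mult:
  "(range_A b R w u \<rho> t *v x) $ X1 i = - (x $ X2 i)"
  "(range_A b R w u \<rho> t *v x) $ X3 k =
      (\<Sum>j\<in>UNIV. (b k v* (skew (w t) ** transpose (R t)) - u t) $ j / \<rho> k t * x $ X1 j)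
      + (\<Sum>j\<in>UNIV. (b k v* transpose (R t)) $ j / \<rho> k t * x $ X2 j) - x $ X4 / \<rho> k t"
  "(range_A b R w u \<rho> t *v x) $ X4 = - (\<Sum>j\<in>UNIV. u t $ j * x $ X2 j) - x $ X5"
  by (simp_all add: matrix_vector_mult_def range_A_def sum_state_idx sum_negf mat_def
      if_distrib[of uminus] if_distribR sum.delta if_distrib[of "\<lambda>c. c * _"] cong: if_cong)

lemma range_C_mult:
  "(range_C b R \<rho> t *v x) $ Inl k = C0_row k \<bullet> (\<chi> j. x $ X3 j)"
  "(range_C b R \<rho> t *v x) $ Inr p = C1_row b R \<rho> t (Rep_rcv_pair p) \<bullet> (\<chi> j. x $ X1 j)
      + C2_row (Rep_rcv_pair p) \<bullet> (\<chi> j. x $ X3 j)"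
  by (simp_all add: matrix_vector_mult_def range_C_def sum_state_idx inner_vec_def)

text \<open>This is algebra at a single time: without the differential equation, a zero output
  already forces the blocks \<open>X1\<close> and \<open>X3\<close> to vanish.\<close>

lemma range_C_mult_eq_0D:
  fixes b :: "'n::{card2, linorder} \<Rightarrow> real^3"
  assumes y: "range_C b R \<rho> t *v x = 0"
    and "rotation_matrix (R t)" and \<rho>: "\<And>i. \<rho> i t > 0" and b: "\<not> coplanar (range b)"
  shows "x $ X1 i = 0" and "x $ X3 k = 0"
proof -
  define v where "v = (\<chi> j. x $ X1 j)"
  have C0: "C0_row k \<bullet> (\<chi> j. x $ X3 j) = 0" for k
    using range_C_mult(1)[of b R \<rho> t x k] y by simp
  \<comment> \<open>The first row of \<open>C0\<close> isolates the least receiver; every other row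
    compares a receiver with it.\<close>
  have "x $ X3 (Min UNIV) = 0"
    using C0[of "Min UNIV"] by (simp add: C0_row_def inner_axis')
  then have X3: "x $ X3 k = 0" for k
    using C0[of k] by (auto simp: C0_row_def inner_axis' inner_diff_left split: if_splits)
  then show "x $ X3 k = 0" .
  have less: "(b i - b j) \<bullet> (transpose (R t) *v v) = 0" if "i < j" for i j
  proof -
    have "Rep_rcv_pair (Abs_rcv_pair (i, j)) = (i, j)"
      using that by (simp add: Abs_rcv_pair_inverse)
    then have "C1_row b R \<rho> t (i, j) \<bullet> v = 0"
      using range_C_mult(2)[of b R \<rho> t x "Abs_rcv_pair (i, j)"] y X3
      by (simp add: v_def inner_vec_def)
    moreover have "\<rho> i t + \<rho> j t \<noteq> 0"
      using \<rho>[of i] \<rho>[of j] by linarith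
    ultimately show ?thesis
      by (simp add: C1_row_def dot_lmul_matrix del: transpose_matrix_vector vector_transpose_matrix)
  qed
  have "transpose (R t) *v v = 0"
  proof (rule not_coplanar_imp_eq_0[OF b])
    \<comment> \<open>Output rows exist only for \<open>i < j\<close>; swapping the indices changes
      the sign, and the diagonal is trivial.\<close>
    show "(b i - b j) \<bullet> (transpose (R t) *v v) = 0" for i j
      using less[of i j] less[of j i]
      by (cases i j rule: linorder_cases) (auto simp: inner_diff_left)
  qed
  then have "R t *v (transpose (R t) *v v) = 0"
    by simp
  then have "v = 0"
    using \<open>rotation_matrix (R t)\<close>
    by (simp add: rotation_matrix_def orthogonal_matrix_def matrix_vector_mul_assoc
        del: transpose_matrix_vector)
  then show "x $ X1 i = 0"
    by (metis v_def vec_lambda_beta zero_index)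
qed

section \<open>Continuity of the coefficient matrices\<close>

lemma bounded_linear_skew: "bounded_linear skew"
  unfolding linear_conv_bounded_linear[symmetric]
  by (rule linearI) (simp_all add: skew_def matrix_def vec_eq_iff cross3_simps forall_3)

lemma continuous_on_range_A:
  assumes R: "continuous_on S R" and w: "continuous_on S w" and u: "continuous_on S u"
    and \<rho>: "\<And>i. continuous_on S (\<rho> i)" "\<And>i t. t \<in> S \<Longrightarrow> \<rho> i t \<noteq> 0"
  shows "continuous_on S (range_A b R w u \<rho>)"
proof -
  have RT: "continuous_on S (\<lambda>t. transpose (R t))"
    by (rule bounded_linear.continuous_on[OF bounded_linear_transpose R])
  have SRT: "continuous_on S (\<lambda>t. skew (w t) ** transpose (R t))"
    by (intro bounded_bilinear.continuous_on[OF bounded_bilinear_matrix_matrix_mult]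
        bounded_linear.continuous_on[OF bounded_linear_skew] w RT)
  have "continuous_on S (\<lambda>t. range_A b R w u \<rho> t $ p $ q)" for p q
    by (cases p; cases q)
       (simp_all add: range_A_def vector_matrix_mult_def,
        (intro continuous_intros RT SRT u \<rho>; simp add: \<rho>)+)
  then have "continuous_on S (\<lambda>t. \<chi> p q. range_A b R w u \<rho> t $ p $ q)"
    by (intro continuous_on_vec_lambda)
  then show ?thesis
    by simp
qed

lemma continuous_on_range_C:
  assumes R: "continuous_on S R"
    and \<rho>: "\<And>i. continuous_on S (\<rho> i)" "\<And>i t. t \<in> S \<Longrightarrow> \<rho> i t > 0"
  shows "continuous_on S (range_C b R \<rho>)"
proof -
  have RT: "continuous_on S (\<lambda>t. transpose (R t))"
    by (rule bounded_linear.continuous_on[OF bounded_linear_transpose R])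
  \<comment> \<open>The denominators in \<open>C1_row\<close> are sums of two ranges, so positivity
    is used here where \<open>range_A\<close> needs nonzero ranges.\<close>
  have pos: "\<rho> i t + \<rho> j t \<noteq> 0" if "t \<in> S" for i j t
    using \<rho>(2)[OF that, of i] \<rho>(2)[OF that, of j] by linarith
  have C1: "continuous_on S (\<lambda>t. C1_row b R \<rho> t ij $ k)" for ij k
    unfolding C1_row_def vector_matrix_mult_def
    by (cases ij) (simp, intro continuous_intros RT \<rho>(1) pos ballI)
  have "continuous_on S (\<lambda>t. range_C b R \<rho> t $ p $ q)" for p q
    by (cases p; cases q) (simp_all add: range_C_def C1)
  then have "continuous_on S (\<lambda>t. \<chi> p q. range_C b R \<rho> t $ p $ q)"
    by (intro continuous_on_vec_lambda)
  then show ?thesis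
    by simp
qed

text \<open>Turns a block that vanishes at all times into an equation for the next block. With
  \<open>a < b\<close>, derivatives within the interval are unique even at its endpoints.\<close>

lemma has_vector_derivative_component_eq_0:
  fixes x :: "real \<Rightarrow> real^'n::finite"
  assumes "a < b" "t \<in> {a..b}" and x: "(x has_vector_derivative d) (at t within {a..b})"
    and zero: "\<And>s. s \<in> {a..b} \<Longrightarrow> x s $ p = 0"
  shows "d $ p = 0"
proof -
  have "((\<lambda>s. x s $ p) has_vector_derivative d $ p) (at t within {a..b})"
    by (rule bounded_linear.has_vector_derivative[OF bounded_linear_vec_nth x])
  then have "((\<lambda>s. 0) has_vector_derivative d $ p) (at t within {a..b})"
    by (rule has_vector_derivative_transform[OF \<open>t \<in> {a..b}\<close>, rotated]) (simp add: zero)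
  then show ?thesis
    using vector_derivative_unique_within_closed_interval[of a b t "\<lambda>_. 0" "d $ p" 0] assms(1,2)
    by simp
qed

theorem theorem1:
  fixes b :: "'n::{card2, linorder} \<Rightarrow> real^3"
    and R :: "real \<Rightarrow> real^3^3"
    and \<omega> u x1 x2 :: "real \<Rightarrow> real^3"
    and \<rho> :: "'n \<Rightarrow> real \<Rightarrow> real"
    and t0 tf Rmin Rmax :: real
  assumes "t0 < tf"
    and "\<And>t. t \<ge> t0 \<Longrightarrow> rotation_matrix (R t)"
    and "\<And>t. t \<ge> t0 \<Longrightarrow> (R has_vector_derivative R t ** skew (\<omega> t)) (at t within {t0..})"
    and "continuous_on {t0..} \<omega>"
    and "continuous_on {t0..} u"
    and "bounded (u ` {t0..})"
    and "\<And>t. t \<ge> t0 \<Longrightarrow> (x1 has_vector_derivative - x2 t - u t) (at t within {t0..})"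
    and "\<And>t. t \<ge> t0 \<Longrightarrow> (x2 has_vector_derivative 0) (at t within {t0..})"
    and "\<And>i t. t \<ge> t0 \<Longrightarrow> \<rho> i t = norm (b i - transpose (R t) *v x1 t)"
    and "\<exists>i j k l. \<not> coplanar {b i, b j, b k, b l}"
    and "Rmin > 0" and "Rmax > 0"
    and "\<And>i t. t \<ge> t0 \<Longrightarrow> Rmin \<le> \<rho> i t \<and> \<rho> i t \<le> Rmax"
  shows "observable_on (range_system b R \<omega> u \<rho>) t0 tf"
proof -
  let ?I = "{t0..tf}"
  have sub: "?I \<subseteq> {t0..}"
    by auto
  have pos: "\<rho> i t > 0" if "t \<in> ?I" for i t
    using assms(11) assms(13)[of t i] that by simp
  have b: "\<not> coplanar (range b)"
    using assms(10) by (meson coplanar_subset empty_subsetI insert_subset rangeI)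
  have R: "continuous_on {t0..} R"
    using assms(3) has_vector_derivative_continuous
    unfolding continuous_on_eq_continuous_within by (metis atLeast_iff)
  have x1: "continuous_on {t0..} x1"
    using assms(7) has_vector_derivative_continuous
    unfolding continuous_on_eq_continuous_within by (metis atLeast_iff)
  \<comment> \<open>Continuity of the ranges is inherited from the given trajectory and the
    rotation, both differentiable.\<close>
  have "continuous_on {t0..} (\<lambda>t. norm (b i - transpose (R t) *v x1 t))" for i
    by (intro continuous_intros R x1
        bounded_bilinear.continuous_on[OF bounded_bilinear_matrix_vector_mult]
        bounded_linear.continuous_on[OF bounded_linear_transpose])
  then have \<rho>: "continuous_on {t0..} (\<rho> i)" for i
    using continuous_on_cong[OF refl assms(9), of "{t0..}"] by simp
  show ?thesis
  proof (rule observable_onI)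
    show "continuous_on ?I (sys_A (range_system b R \<omega> u \<rho>))"
      unfolding range_system_def ltv_system.select_convs
      by (rule continuous_on_range_A)
         (use pos in \<open>auto intro!: continuous_on_subset[OF _ sub] R \<rho> assms simp: less_imp_neq[symmetric]\<close>)
    show "continuous_on ?I (sys_C (range_system b R \<omega> u \<rho>))"
      unfolding range_system_def ltv_system.select_convs
      by (rule continuous_on_range_C)
         (use pos in \<open>auto intro!: continuous_on_subset[OF _ sub] R \<rho>\<close>)
    fix x :: "real \<Rightarrow> real^'n state_idx"
    assume "\<And>t. t \<in> ?I \<Longrightarrow> (x has_vector_derivative
        sys_A (range_system b R \<omega> u \<rho>) t *v x t) (at t within ?I)"
      and "\<And>t. t \<in> ?I \<Longrightarrow> sys_C (range_system b R \<omega> u \<rho>) t *v x t = 0"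
    then have x: "(x has_vector_derivative range_A b R \<omega> u \<rho> t *v x t) (at t within ?I)"
      and y: "range_C b R \<rho> t *v x t = 0" if "t \<in> ?I" for t
      using that by (simp_all add: range_system_def)
    note deriv = has_vector_derivative_component_eq_0[OF \<open>t0 < tf\<close> _ x]
    have X1: "x t $ X1 i = 0" and X3: "x t $ X3 k = 0" if "t \<in> ?I" for t i k
      using range_C_mult_eq_0D[OF y[OF that] _ pos[OF that] b] assms(2) that by auto
    have X2: "x t $ X2 i = 0" if "t \<in> ?I" for t i
      using deriv[OF that that X1] by (simp add: range_A_mult)
    \<comment> \<open>Any receiver's row will do, here that of \<open>undefined\<close>: once
      \<open>X1\<close> and \<open>X2\<close> vanish, it reduces to \<open>X4\<close> divided by a
      positive range, up to sign.\<close>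
    have X4: "x t $ X4 = 0" if "t \<in> ?I" for t
      using deriv[OF that that X3, of undefined] pos[OF that, of undefined] X1[OF that] X2[OF that]
      by (simp add: range_A_mult)
    have X5: "x t $ X5 = 0" if "t \<in> ?I" for t
      using deriv[OF that that X4] X2[OF that] by (simp add: range_A_mult)
    have "x t0 $ p = 0" for p
      using X1 X2 X3 X4 X5 \<open>t0 < tf\<close> by (cases p) auto
    then show "x t0 = 0"
      by (simp add: vec_eq_iff)
  qed (rule \<open>t0 < tf\<close>)
qed

end
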